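(* Let $n\ge1$ be an integer. If $A\subset\mathbb{R}^{n+1}$ and $f:A\to\mathbb{P}^n$ is Lipschitz, where $A$ carries the Euclidean metric and $\mathbb{P}^n$ the parabolic metric $d$, then $\mathcal{H}^{n+1}(f(A))=0$.
   Context: $\mathbb{P}^n=\mathbb{R}^n\times\mathbb{R}$ with $\|(x,t)\|=\sqrt{|x|^2+|t|}$ ($|\cdot|$ Euclidean) and the metric $d(p,q)=\|p-q\|$. $\mathcal{H}^s$ is the Hausdorff measure with respect to $d$, $\mathcal{H}^s(A)=\lim_{\delta\to0}\inf\{\sum_i d(E_i)^s: A\subset\bigcup_i E_i,\ d(E_i)<\delta\}$, $d(E_i)$ being the $d$-diameter of $E_i$. *)

theory Defs
  imports "HOL-Analysis.Analysis"
begin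

definition parabolic_norm :: "(real ^ 'n) \<times> real \<Rightarrow> real" where
  "parabolic_norm p = sqrt ((norm (fst p))\<^sup>2 + \<bar>snd p\<bar>)"

definition parabolic_dist :: "(real ^ 'n) \<times> real \<Rightarrow> (real ^ 'n) \<times> real \<Rightarrow> real" where
  "parabolic_dist p q = parabolic_norm (p - q)"

(* The distance of the metric_space instance on pairs is Euclidean, so the parabolic space
   has to be an explicit object of type metric. *)
definition parabolic_metric :: "((real ^ 'n) \<times> real) metric" where
  "parabolic_metric = metric (UNIV, parabolic_dist)"

lemma parabolic_norm_triangle:
  "parabolic_norm (p + q) \<le> parabolic_norm p + parabolic_norm q"
proof -
  have "\<bar>snd p + snd q\<bar> \<le> (sqrt \<bar>snd p\<bar> + sqrt \<bar>snd q\<bar>)\<^sup>2"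
    by (simp add: power2_sum) (smt (verit) mult_nonneg_nonneg real_sqrt_ge_0_iff)
  moreover have "(norm (fst p + fst q))\<^sup>2 \<le> (norm (fst p) + norm (fst q))\<^sup>2"
    by (intro power_mono norm_triangle_ineq norm_ge_zero)
  ultimately have "parabolic_norm (p + q)
      \<le> sqrt ((norm (fst p) + norm (fst q))\<^sup>2 + (sqrt \<bar>snd p\<bar> + sqrt \<bar>snd q\<bar>)\<^sup>2)"
    unfolding parabolic_norm_def by (intro real_sqrt_le_mono) (simp add: add_mono)
  also have "\<dots> \<le> parabolic_norm p + parabolic_norm q"
    using real_sqrt_sum_squares_triangle_ineq
      [of "norm (fst p)" "norm (fst q)" "sqrt \<bar>snd p\<bar>" "sqrt \<bar>snd q\<bar>"]
    by (simp add: parabolic_norm_def)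
  finally show ?thesis .
qed

lemma Metric_space_parabolic: "Metric_space UNIV parabolic_dist"
proof
  fix x y z :: "(real ^ 'n) \<times> real"
  show "0 \<le> parabolic_dist x y"
    by (simp add: parabolic_dist_def parabolic_norm_def)
  show "parabolic_dist x y = parabolic_dist y x"
    by (simp add: parabolic_dist_def parabolic_norm_def norm_minus_commute abs_minus_commute)
  show "parabolic_dist x y = 0 \<longleftrightarrow> x = y"
    by (simp add: parabolic_dist_def parabolic_norm_def prod_eq_iff add_nonneg_eq_0_iff)
  show "parabolic_dist x z \<le> parabolic_dist x y + parabolic_dist y z"
    using parabolic_norm_triangle[of "x - y" "y - z"] by (simp add: parabolic_dist_def)
qed

lemma mspace_parabolic_metric [simp]: "mspace parabolic_metric = UNIV"
  by (simp add: parabolic_metric_def Metric_space.mspace_metric Metric_space_parabolic)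

lemma mdist_parabolic_metric [simp]: "mdist parabolic_metric = parabolic_dist"
  by (simp add: parabolic_metric_def Metric_space.mdist_metric Metric_space_parabolic)

definition mdiameter :: "'a metric \<Rightarrow> 'a set \<Rightarrow> ennreal" where
  "mdiameter m E = (SUP x\<in>E. SUP y\<in>E. ennreal (mdist m x y))"

(* The s-th power of the diameter.  In hausdorff_pre only sets of finite diameter occur, so
   enn2real loses nothing.  The case s = 0 is the usual convention (counting measure), which
   powr does not give because 0 powr 0 = 0. *)
definition mdiameter_powr :: "'a metric \<Rightarrow> real \<Rightarrow> 'a set \<Rightarrow> ennreal" where
  "mdiameter_powr m s E =
     (if s = 0 then of_bool (E \<noteq> {}) else ennreal (enn2real (mdiameter m E) powr s))"

(* Covers are indexed by nat; finite covers are included, since E i may be empty. *)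
definition hausdorff_pre :: "'a metric \<Rightarrow> real \<Rightarrow> real \<Rightarrow> 'a set \<Rightarrow> ennreal" where
  "hausdorff_pre m s \<delta> A =
     (INF E \<in> {E :: nat \<Rightarrow> 'a set. (\<forall>i. E i \<subseteq> mspace m) \<and> A \<subseteq> (\<Union>i. E i)
                                  \<and> (\<forall>i. mdiameter m (E i) < ennreal \<delta>)}.
        \<Sum>i. mdiameter_powr m s (E i))"

definition hausdorff_measure :: "'a metric \<Rightarrow> real \<Rightarrow> 'a set \<Rightarrow> ennreal" where
  "hausdorff_measure m s A = Lim (at_right 0) (\<lambda>\<delta>. hausdorff_pre m s \<delta> A)"

lemma hausdorff_pre_antimono:
  assumes "\<delta> \<le> \<epsilon>"
  shows "hausdorff_pre m s \<epsilon> A \<le> hausdorff_pre m s \<delta> A"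
  unfolding hausdorff_pre_def
  by (intro INF_superset_mono) (use assms in \<open>auto intro: less_le_trans ennreal_leI\<close>)

lemma tendsto_hausdorff_pre:
  "((\<lambda>\<delta>. hausdorff_pre m s \<delta> A) \<longlongrightarrow> (SUP \<delta>\<in>{0<..}. hausdorff_pre m s \<delta> A)) (at_right 0)"
proof (rule order_tendstoI)
  fix a assume "a < (SUP \<delta>\<in>{0<..}. hausdorff_pre m s \<delta> A)"
  then obtain \<epsilon> where "\<epsilon> > 0" "a < hausdorff_pre m s \<epsilon> A"
    by (auto simp: less_SUP_iff)
  then show "\<forall>\<^sub>F \<delta> in at_right 0. a < hausdorff_pre m s \<delta> A"
    unfolding eventually_at_right_field
    by (meson hausdorff_pre_antimono less_le_trans less_imp_le)
next
  fix a assume a: "(SUP \<delta>\<in>{0<..}. hausdorff_pre m s \<delta> A) < a"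
  have "hausdorff_pre m s \<delta> A < a" if "\<delta> > 0" for \<delta>
    using a by (rule le_less_trans[rotated]) (use that in \<open>auto intro: SUP_upper\<close>)
  then show "\<forall>\<^sub>F \<delta> in at_right 0. hausdorff_pre m s \<delta> A < a"
    by (auto simp: eventually_at_right_field intro: exI[of _ 1])
qed

lemma hausdorff_measure_eq_SUP:
  "hausdorff_measure m s A = (SUP \<delta>\<in>{0<..}. hausdorff_pre m s \<delta> A)"
  unfolding hausdorff_measure_def
  by (rule tendsto_Lim[OF _ tendsto_hausdorff_pre]) simp

end

theory Submission
  imports Defs
begin

text \<open>
  Write f = (g, h) with g taking values in n-space; then g is Lipschitz and h is
  Lipschitz with respect to the squared distance.  Cut the domain, of dimension n + 1, into
  cells of side R, and each cell into K^(n + 1) subcells with K = p^2.  If every subcell meets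
  A, any two points of A in the cell are joined by a chain of about K points of A with steps
  of order R / K, so h varies by only O(K (R / K)^2) = O((R / p)^2) on the cell.  The image
  of the cell is therefore covered by O(p^n) sets of parabolic diameter O(R / p), which
  contribute O(R^(n + 1) / p).  The remaining cells contribute O(R^(n + 1)) each, but they are
  rare: the total volume V(R) of the cells meeting A is monotone along R = K^(-j), hence
  convergent, and every cell with a missed subcell adds at least (R / K)^(n + 1) to V(R) - V(R / K).
\<close>

section \<open>Diameter bounds and countable subadditivity of the Hausdorff premeasures\<close>

lemma mdiameter_le:
  assumes "\<And>x y. x \<in> E \<Longrightarrow> y \<in> E \<Longrightarrow> mdist m x y \<le> d"
  shows "mdiameter m E \<le> ennreal d"
  unfolding mdiameter_def using assms by (intro SUP_least ennreal_leI)

lemma mdiameter_powr_le: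
  assumes "s > 0" "d \<ge> 0" and "\<And>x y. x \<in> E \<Longrightarrow> y \<in> E \<Longrightarrow> mdist m x y \<le> d"
  shows "mdiameter_powr m s E \<le> ennreal (d powr s)"
proof -
  have "enn2real (mdiameter m E) \<le> d"
    using mdiameter_le[of E m d] assms by (intro enn2real_leI) auto
  then show ?thesis
    using assms by (auto simp: mdiameter_powr_def intro!: ennreal_leI powr_mono2)
qed

lemma mdiameter_empty [simp]: "mdiameter m {} = 0"
  by (simp add: mdiameter_def bot_ennreal)

lemma mdiameter_powr_empty [simp]: "mdiameter_powr m s {} = 0"
  by (simp add: mdiameter_powr_def)

lemma hausdorff_pre_le:
  assumes "\<And>i. E i \<subseteq> mspace m" "A \<subseteq> (\<Union>i. E i)" "\<And>i. mdiameter m (E i) < ennreal \<delta>"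
  shows "hausdorff_pre m s \<delta> A \<le> (\<Sum>i. mdiameter_powr m s (E i))"
  unfolding hausdorff_pre_def using assms by (intro INF_lower) auto

lemma hausdorff_pre_lessE:
  assumes "hausdorff_pre m s \<delta> A < c"
  obtains E where "\<And>i. E i \<subseteq> mspace m" "A \<subseteq> (\<Union>i. E i)"
    "\<And>i. mdiameter m (E i) < ennreal \<delta>" "(\<Sum>i. mdiameter_powr m s (E i)) < c"
  using assms unfolding hausdorff_pre_def INF_less_iff by blast

lemma hausdorff_pre_le_mdiameter_powr:
  assumes "E \<subseteq> mspace m" "mdiameter m E < ennreal \<delta>"
  shows "hausdorff_pre m s \<delta> E \<le> mdiameter_powr m s E"
proof -
  let ?E = "\<lambda>i::nat. if i = 0 then E else {}"
  \<comment> \<open>Strictness of the diameter bound forces a positive threshold, so the empty sets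
    that pad the cover are admissible.\<close>
  have "0 < ennreal \<delta>"
    using assms(2) by (rule le_less_trans[rotated]) simp
  then have "hausdorff_pre m s \<delta> E \<le> (\<Sum>i. mdiameter_powr m s (?E i))"
    using assms by (intro hausdorff_pre_le) auto
  also have "\<dots> = (\<Sum>i\<in>{0}. mdiameter_powr m s (?E i))"
    by (rule suminf_finite) auto
  finally show ?thesis by simp
qed

lemma hausdorff_pre_empty:
  assumes "\<delta> > 0" shows "hausdorff_pre m s \<delta> {} = 0"
  using hausdorff_pre_le_mdiameter_powr[of "{}" m \<delta> s] assms by simp

lemma hausdorff_pre_le_powr:
  assumes "E \<subseteq> mspace m" "s > 0" "0 \<le> d" "d < \<delta>"
    and "\<And>x y. x \<in> E \<Longrightarrow> y \<in> E \<Longrightarrow> mdist m x y \<le> d"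
  shows "hausdorff_pre m s \<delta> E \<le> ennreal (d powr s)"
proof -
  have "mdiameter m E < ennreal \<delta>"
    using mdiameter_le[of E m d] assms by (meson ennreal_lessI le_less_trans)
  then show ?thesis
    using hausdorff_pre_le_mdiameter_powr[of E m \<delta> s] mdiameter_powr_le[of s d E m] assms
    by (meson order_trans)
qed

text \<open>Choose for the i-th set a cover whose sum is within e/2^(i+1) of the infimum, and merge
  all these covers into one sequence.\<close>

lemma hausdorff_pre_UN_le:
  fixes X :: "nat \<Rightarrow> 'a set"
  shows "hausdorff_pre m s \<delta> (\<Union>i. X i) \<le> (\<Sum>i. hausdorff_pre m s \<delta> (X i))"
proof (rule ennreal_le_epsilon)
  fix e :: real assume fin: "(\<Sum>i. hausdorff_pre m s \<delta> (X i)) < top" and "e > 0"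
  have "\<exists>E. (\<forall>k. E k \<subseteq> mspace m) \<and> X i \<subseteq> (\<Union>k. E k) \<and> (\<forall>k. mdiameter m (E k) < ennreal \<delta>) \<and>
     (\<Sum>k. mdiameter_powr m s (E k)) < hausdorff_pre m s \<delta> (X i) + ennreal (e * (1/2) ^ Suc i)" for i
  proof -
    \<comment> \<open>A finite total makes each term finite. Only then does adding a positive amount
      give a strictly larger value, below which a cover exists.\<close>
    have "hausdorff_pre m s \<delta> (X i) \<noteq> top"
      using ennreal_suminf_lessD[OF fin, of i] by simp
    then have "hausdorff_pre m s \<delta> (X i) + 0 < hausdorff_pre m s \<delta> (X i) + ennreal (e * (1/2) ^ Suc i)"
      using \<open>e > 0\<close> by (simp only: ennreal_add_left_cancel_less) simp
    then have "hausdorff_pre m s \<delta> (X i) < hausdorff_pre m s \<delta> (X i) + ennreal (e * (1/2) ^ Suc i)"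
      by (simp only: add_0_right)
    then show ?thesis
      by (elim hausdorff_pre_lessE) blast
  qed
  then have "\<exists>E. \<forall>i. (\<forall>k. E i k \<subseteq> mspace m) \<and> X i \<subseteq> (\<Union>k. E i k) \<and> (\<forall>k. mdiameter m (E i k) < ennreal \<delta>) \<and>
     (\<Sum>k. mdiameter_powr m s (E i k)) < hausdorff_pre m s \<delta> (X i) + ennreal (e * (1/2) ^ Suc i)"
    by (intro choice allI)
  then obtain E where E: "\<And>i k. E i k \<subseteq> mspace m" "\<And>i. X i \<subseteq> (\<Union>k. E i k)"
      "\<And>i k. mdiameter m (E i k) < ennreal \<delta>"
      "\<And>i. (\<Sum>k. mdiameter_powr m s (E i k))
         < hausdorff_pre m s \<delta> (X i) + ennreal (e * (1/2) ^ Suc i)"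
    by blast
  \<comment> \<open>\<open>prod_decode\<close> lists the double family as a single sequence, since
    covers are indexed by \<open>nat\<close>.\<close>
  have "hausdorff_pre m s \<delta> (\<Union>i. X i) \<le> (\<Sum>k. mdiameter_powr m s (case_prod E (prod_decode k)))"
  proof (rule hausdorff_pre_le)
    show "(\<Union>i. X i) \<subseteq> (\<Union>k. case_prod E (prod_decode k))"
    proof
      fix x assume "x \<in> (\<Union>i. X i)"
      then obtain i k where "x \<in> E i k" using E(2) by blast
      then show "x \<in> (\<Union>k. case_prod E (prod_decode k))"
        by (intro UN_I[of "prod_encode (i, k)"]) auto
    qed
  qed (use E in \<open>auto split: prod.split\<close>)
  also have "\<dots> = (\<Sum>i. \<Sum>k. mdiameter_powr m s (E i k))"
    using suminf_ennreal_2dimen[where f = "\<lambda>(i, k). mdiameter_powr m s (E i k)"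
        and g = "\<lambda>i. \<Sum>k. mdiameter_powr m s (E i k)"]
    by (simp add: o_def split_beta)
  also have "\<dots> \<le> (\<Sum>i. hausdorff_pre m s \<delta> (X i) + ennreal (e * (1/2) ^ Suc i))"
    using E(4) by (intro suminf_le less_imp_le) auto
  also have "\<dots> = (\<Sum>i. hausdorff_pre m s \<delta> (X i)) + (\<Sum>i. ennreal (e * (1/2) ^ Suc i))"
    by (subst suminf_add) auto
  also have "(\<Sum>i. ennreal (e * (1/2) ^ Suc i)) = ennreal e"
    using \<open>e > 0\<close> sums_mult[OF power_half_series, of e] by (intro suminf_ennreal_eq) auto
  finally show "hausdorff_pre m s \<delta> (\<Union>i. X i) \<le> (\<Sum>i. hausdorff_pre m s \<delta> (X i)) + ennreal e" .
qed

text \<open>\<open>binaryset X Y\<close> is the sequence X, Y, then empty sets; these contribute 0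
  because the threshold is positive.\<close>

lemma hausdorff_pre_Un_le:
  assumes "\<delta> > 0"
  shows "hausdorff_pre m s \<delta> (X \<union> Y) \<le> hausdorff_pre m s \<delta> X + hausdorff_pre m s \<delta> Y"
proof -
  have "hausdorff_pre m s \<delta> (X \<union> Y) \<le> (\<Sum>i. hausdorff_pre m s \<delta> (binaryset X Y i))"
    using hausdorff_pre_UN_le[of m s \<delta> "binaryset X Y"] by (simp add: UN_binaryset_eq)
  also have "\<dots> = hausdorff_pre m s \<delta> X + hausdorff_pre m s \<delta> Y"
    by (rule suminf_binaryset_eq) (simp add: hausdorff_pre_empty assms)
  finally show ?thesis .
qed

lemma hausdorff_pre_finite_UN_le:
  assumes "\<delta> > 0" "finite I"
  shows "hausdorff_pre m s \<delta> (\<Union>i\<in>I. X i) \<le> (\<Sum>i\<in>I. hausdorff_pre m s \<delta> (X i))"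
  using assms(2)
proof induction
  case (insert i I)
  then show ?case
    using hausdorff_pre_Un_le[OF assms(1), of m s "X i" "\<Union>i\<in>I. X i"]
    by (auto intro: order_trans add_left_mono)
qed (simp add: hausdorff_pre_empty assms)

section \<open>Spatial and time components of the parabolic distance\<close>

lemma parabolic_dist_nonneg: "0 \<le> parabolic_dist p q"
  by (simp add: parabolic_dist_def parabolic_norm_def)

lemma norm_fst_diff_le_parabolic_dist: "norm (fst p - fst q) \<le> parabolic_dist p q"
  by (simp add: parabolic_dist_def parabolic_norm_def real_le_rsqrt)

text \<open>The square is the source of the whole gain: along a Lipschitz map the time coordinate
  varies quadratically, so chains of many short steps change it little.\<close>

lemma abs_snd_diff_le_parabolic_dist: "\<bar>snd p - snd q\<bar> \<le> (parabolic_dist p q)\<^sup>2"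
  by (simp add: parabolic_dist_def parabolic_norm_def)

lemma parabolic_dist_le: "parabolic_dist p q \<le> norm (fst p - fst q) + sqrt \<bar>snd p - snd q\<bar>"
  unfolding parabolic_dist_def parabolic_norm_def
  by (rule order_trans[OF sqrt_add_le_add_sqrt]) auto

section \<open>Grid cells, their subdivision and their number\<close>

lemma finite_card_vec_box:
  fixes S :: "'m::finite \<Rightarrow> 'a set"
  assumes "\<And>i. finite (S i)"
  shows "finite {v. \<forall>i. v $ i \<in> S i}" "card {v. \<forall>i. v $ i \<in> S i} = (\<Prod>i\<in>UNIV. card (S i))"
proof -
  have bij: "bij_betw vec_nth {v. \<forall>i. v $ i \<in> S i} (PiE UNIV S)"
    by (rule bij_betwI[where g = vec_lambda]) auto
  show "finite {v. \<forall>i. v $ i \<in> S i}"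
    using bij_betw_finite[OF bij] assms by (simp add: finite_PiE)
  show "card {v. \<forall>i. v $ i \<in> S i} = (\<Prod>i\<in>UNIV. card (S i))"
    using bij_betw_same_card[OF bij] by (simp add: card_PiE)
qed

text \<open>The index of the half-open cube of side 1/s that contains x. With the reciprocal of the
  side as parameter, refining by K is multiplication of s by K.\<close>

definition cell :: "real \<Rightarrow> real ^ 'm \<Rightarrow> int ^ 'm" where
  "cell s x = (\<chi> i. \<lfloor>s * x $ i\<rfloor>)"

text \<open>The indices, in the grid refined by K, of the pieces of the cell q. As
  \<open>div\<close> rounds down, this is also right for negative indices.\<close>

definition subcells :: "nat \<Rightarrow> int ^ 'm \<Rightarrow> (int ^ 'm) set" where
  "subcells K q = {r. \<forall>i. r $ i div int K = q $ i}"

lemma norm_le_card_mult: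
  fixes x :: "real ^ 'm" and c :: real
  assumes "\<And>i. \<bar>x $ i\<bar> \<le> c"
  shows "norm x \<le> CARD('m) * c"
  using norm_le_l1_cart[of x] sum_bounded_above[of UNIV "\<lambda>i. \<bar>x $ i\<bar>" c] assms by simp

text \<open>Points in equal or touching cells, diagonal contact included, differ by at most 2/s in
  each coordinate. One constant thus serves both for diameters of cells and for steps of a
  chain.\<close>

lemma dist_le_cell:
  fixes x y :: "real ^ 'm"
  assumes "s > 0" "\<And>i. \<bar>cell s x $ i - cell s y $ i\<bar> \<le> 1"
  shows "dist x y \<le> 2 * CARD('m) / s"
proof -
  have "\<bar>(x - y) $ i\<bar> \<le> 2 / s" for i
  proof -
    have "\<bar>s * x $ i - s * y $ i\<bar> \<le> 2"
      using assms(2)[of i] unfolding cell_def by simp linarith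
    then have "s * \<bar>x $ i - y $ i\<bar> \<le> 2"
      using assms(1) by (simp add: abs_mult flip: right_diff_distrib)
    then show ?thesis using assms(1) by (simp add: field_simps)
  qed
  from norm_le_card_mult[OF this] show ?thesis by (simp add: dist_norm mult.commute)
qed

text \<open>Nested floors: rounding down before dividing by the integer K does not change the
  rounded quotient.\<close>

lemma cell_in_subcells:
  assumes "K > 0" shows "cell (s * real K) x \<in> subcells K (cell s x)"
  using assms floor_divide_real_eq_div[of "int K" "s * real K * x $ i" for i]
  by (simp add: cell_def subcells_def)

lemma finite_cell_image:
  fixes A :: "(real ^ 'm) set"
  assumes "bounded A" shows "finite (cell s ` A)"
proof -
  obtain B where B: "\<And>x. x \<in> A \<Longrightarrow> norm x \<le> B" using assms by (auto simp: bounded_iff)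
  have "cell s ` A \<subseteq> {v. \<forall>i. v $ i \<in> {-\<lceil>\<bar>s\<bar> * B\<rceil> - 1..\<lceil>\<bar>s\<bar> * B\<rceil>}}"
  proof clarify
    fix x i assume "x \<in> A"
    then have "\<bar>s * x $ i\<bar> \<le> \<bar>s\<bar> * B"
      using B[of x] component_le_norm_cart[of x i] by (auto simp: abs_mult intro!: mult_left_mono)
    then show "cell s x $ i \<in> {-\<lceil>\<bar>s\<bar> * B\<rceil> - 1..\<lceil>\<bar>s\<bar> * B\<rceil>}"
      unfolding cell_def by simp linarith
  qed
  then show ?thesis by (rule finite_subset) (intro finite_card_vec_box, simp)
qed

lemma finite_card_subcells:
  fixes q :: "int ^ 'm"
  assumes "K > 0"
  shows "finite (subcells K q)" "card (subcells K q) = K ^ CARD('m)"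
proof -
  have "a div int K = b \<longleftrightarrow> a \<in> {b * int K..<b * int K + int K}" for a b
  proof
    assume "a div int K = b"
    then have "b * int K + a mod int K = a"
      using div_mult_mod_eq[of a "int K"] by simp
    moreover have "0 \<le> a mod int K" "a mod int K < int K"
      using assms by simp_all
    ultimately show "a \<in> {b * int K..<b * int K + int K}"
      unfolding atLeastLessThan_iff by linarith
  next
    assume "a \<in> {b * int K..<b * int K + int K}"
    then show "a div int K = b"
      by (intro int_div_pos_eq[of _ _ _ "a - b * int K"]) (auto simp: mult.commute)
  qed
  then have eq: "subcells K q = {r. \<forall>i. r $ i \<in> {q $ i * int K..<q $ i * int K + int K}}"
    by (simp add: subcells_def)
  show "finite (subcells K q)" "card (subcells K q) = K ^ CARD('m)"
    unfolding eq by (simp_all add: finite_card_vec_box del: atLeastLessThan_iff)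
qed

text \<open>Count occupied subcells parent by parent: a parent has at most K^m of them, and at least
  one fewer if a subcell is missed. After division by (s K)^m this bounds the number of defective
  cells by a loss of volume.\<close>

lemma card_cell_image_refine:
  fixes A :: "(real ^ 'm) set"
  assumes "bounded A" "K > 0"
  shows "card (cell (s * real K) ` A)
       + card {q \<in> cell s ` A. \<not> subcells K q \<subseteq> cell (s * real K) ` A}
     \<le> K ^ CARD('m) * card (cell s ` A)"
proof -
  let ?S = "cell s ` A" and ?T = "cell (s * real K) ` A"
  have fin: "finite ?S" "finite ?T" using assms(1) by (simp_all add: finite_cell_image)
  have "?T \<subseteq> (\<Union>q\<in>?S. ?T \<inter> subcells K q)"
    using cell_in_subcells[OF assms(2)] by blast
  then have "card ?T \<le> (\<Sum>q\<in>?S. card (?T \<inter> subcells K q))"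
    by (rule order_trans[OF card_mono card_UN_le, rotated]) (use fin in auto)
  moreover have "card {q \<in> ?S. \<not> subcells K q \<subseteq> ?T} = (\<Sum>q\<in>?S. if subcells K q \<subseteq> ?T then 0 else 1)"
    using fin(1) by (simp add: sum.If_cases Int_def)
  moreover have "card (?T \<inter> subcells K q) + (if subcells K q \<subseteq> ?T then 0 else 1) \<le> K ^ CARD('m)" for q
  proof (cases "subcells K q \<subseteq> ?T")
    case True
    then show ?thesis
      using finite_card_subcells[OF assms(2), of q] by (simp add: Int_absorb1)
  next
    case False
    then have "card (?T \<inter> subcells K q) < card (subcells K q)"
      using finite_card_subcells[OF assms(2), of q] by (intro psubset_card_mono) auto
    then show ?thesis using False finite_card_subcells[OF assms(2), of q] by simp
  qed
  then have "(\<Sum>q\<in>?S. card (?T \<inter> subcells K q) + (if subcells K q \<subseteq> ?T then 0 else 1))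
      \<le> (\<Sum>q\<in>?S. K ^ CARD('m))"
    by (rule sum_mono)
  ultimately show ?thesis by (simp add: sum.distrib mult.commute)
qed

section \<open>Chains in a full cell, and coverings of the image of one cell\<close>

text \<open>Pick a point of A in every subcell and walk from the subcell of x to that of y in K
  moves between equal or touching subcells. Two more moves exchange x and y for the chosen points,
  whence K + 2.\<close>

lemma oscillation_on_full_cell:
  fixes A :: "(real ^ 'm) set" and h :: "real ^ 'm \<Rightarrow> real"
  assumes h: "\<And>x y. x \<in> A \<Longrightarrow> y \<in> A \<Longrightarrow> \<bar>h x - h y\<bar> \<le> c * (dist x y)\<^sup>2"
    and "c \<ge> 0" "s > 0" "K > 0" and full: "subcells K q \<subseteq> cell (s * real K) ` A"
    and "x \<in> A" "y \<in> A" "cell s x = q" "cell s y = q"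
  shows "\<bar>h x - h y\<bar> \<le> (real K + 2) * (c * (2 * CARD('m) / (s * real K))\<^sup>2)"
proof -
  let ?cell = "cell (s * real K) :: real ^ 'm \<Rightarrow> int ^ 'm"
  let ?b = "c * (2 * CARD('m) / (s * real K))\<^sup>2"
  define u v where "u = ?cell x" and "v = ?cell y"
  have step: "\<bar>h a - h b\<bar> \<le> ?b"
    if "a \<in> A" "b \<in> A" "\<And>i. \<bar>?cell a $ i - ?cell b $ i\<bar> \<le> 1" for a b
  proof -
    have "dist a b \<le> 2 * CARD('m) / (s * real K)"
      using that assms by (intro dist_le_cell) auto
    then have "c * (dist a b)\<^sup>2 \<le> ?b"
      using \<open>c \<ge> 0\<close> by (intro mult_left_mono power_mono) auto
    then show ?thesis using h[OF that(1,2)] by linarith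
  qed
  have uv: "u \<in> subcells K q" "v \<in> subcells K q"
    using cell_in_subcells[OF \<open>K > 0\<close>, of s x] cell_in_subcells[OF \<open>K > 0\<close>, of s y] assms
    by (simp_all add: u_def v_def)
  have "\<forall>r\<in>subcells K q. \<exists>a. a \<in> A \<and> ?cell a = r"
    using full by blast
  then obtain a where a: "\<And>r. r \<in> subcells K q \<Longrightarrow> a r \<in> A \<and> ?cell (a r) = r"
    using bchoice[of "subcells K q" "\<lambda>r a. a \<in> A \<and> ?cell a = r"] by blast
  \<comment> \<open>\<open>w t\<close> moves every coordinate of \<open>u\<close> by at most \<open>t\<close> towards that of \<open>v\<close>\<close>
  define w where "w t = (\<chi> i. max (min (v $ i) (u $ i + int t)) (u $ i - int t))" for t :: nat
  have w_sub: "w t \<in> subcells K q" for t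
  proof -
    have "w t $ i div int K = q $ i" for i
    proof -
      \<comment> \<open>Each coordinate of \<open>w t\<close> lies between those of \<open>u\<close>
        and \<open>v\<close>; \<open>div\<close> is monotone and agrees at both ends, so the walk
        never leaves the cell.\<close>
      have "min (u $ i) (v $ i) \<le> w t $ i" "w t $ i \<le> max (u $ i) (v $ i)"
        by (auto simp: w_def)
      then have "min (u $ i) (v $ i) div int K \<le> w t $ i div int K"
        "w t $ i div int K \<le> max (u $ i) (v $ i) div int K"
        using \<open>K > 0\<close> by (auto intro!: zdiv_mono1 simp del: min_le_iff_disj le_max_iff_disj)
      moreover have "u $ i div int K = q $ i" "v $ i div int K = q $ i"
        using uv by (auto simp: subcells_def)
      ultimately show ?thesis by (auto simp: min_def max_def split: if_splits)
    qed
    then show ?thesis by (simp add: subcells_def)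
  qed
  have chain: "\<bar>h (a (w t)) - h (a u)\<bar> \<le> real t * ?b" for t
  proof (induction t)
    case 0
    have "w 0 = u" by (simp add: w_def vec_eq_iff)
    then show ?case by simp
  next
    case (Suc t)
    have "\<bar>w (Suc t) $ i - w t $ i\<bar> \<le> 1" for i
      by (auto simp: w_def min_def max_def)
    then have "\<bar>h (a (w (Suc t))) - h (a (w t))\<bar> \<le> ?b"
      using a[OF w_sub] by (intro step) auto
    then show ?case using Suc by (simp add: algebra_simps)
  qed
  have "w K = v"
  proof -
    have "w K $ i = v $ i" for i
    proof -
      have "u $ i div int K = q $ i" "v $ i div int K = q $ i"
        using uv by (auto simp: subcells_def)
      \<comment> \<open>Integers with the same quotient by K differ by less than K, so K moves reach
        \<open>v\<close>.\<close>
      then have "u $ i = int K * q $ i + u $ i mod int K" "v $ i = int K * q $ i + v $ i mod int K"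
        by (metis mult_div_mod_eq)+
      moreover have "u $ i mod int K < int K" "v $ i mod int K < int K"
        "0 \<le> u $ i mod int K" "0 \<le> v $ i mod int K" using \<open>K > 0\<close> by auto
      ultimately have "u $ i - int K \<le> v $ i" "v $ i \<le> u $ i + int K" by linarith+
      then show ?thesis by (simp add: w_def)
    qed
    then show ?thesis by (simp add: vec_eq_iff)
  qed
  moreover have "\<bar>h x - h (a u)\<bar> \<le> ?b" "\<bar>h y - h (a v)\<bar> \<le> ?b"
    using a[OF uv(1)] a[OF uv(2)] \<open>x \<in> A\<close> \<open>y \<in> A\<close>
    by (intro step; simp add: u_def v_def)+
  ultimately show ?thesis
    using chain[of K] by (simp add: distrib_right)
qed

text \<open>Only the n spatial coordinates are cut, into p parts per length \<open>a\<close>; the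
  time coordinate already oscillates little enough by the chain argument. About p^n pieces of
  diameter D/(s p), raised to the power n + 1, leave a factor 1/p.\<close>

lemma hausdorff_pre_full_cell:
  fixes A :: "(real ^ 'm) set" and f :: "real ^ 'm \<Rightarrow> (real ^ 'n) \<times> real" and L :: real
  assumes lip: "\<And>x y. x \<in> A \<Longrightarrow> y \<in> A \<Longrightarrow> parabolic_dist (f x) (f y) \<le> L * dist x y"
    and "L > 0" "s > 0" "p > 0" and full: "subcells (p\<^sup>2) q \<subseteq> cell (s * real (p\<^sup>2)) ` A"
    and D: "D = 6 * CARD('n) * CARD('m) * L" and "D / s < \<delta>"
  shows "hausdorff_pre parabolic_metric (real (CARD('n) + 1)) \<delta> (f ` {x \<in> A. cell s x = q})
     \<le> ennreal (3 ^ CARD('n) * D ^ (CARD('n) + 1) / (real p * s ^ (CARD('n) + 1)))"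
proof (cases "{x \<in> A. cell s x = q} = {}")
  case True
  have "D \<ge> 0" unfolding D using \<open>L > 0\<close> by simp
  then have "0 \<le> D / s" using \<open>s > 0\<close> by simp
  then have "\<delta> > 0" using \<open>D / s < \<delta>\<close> by linarith
  then show ?thesis unfolding True by (simp add: hausdorff_pre_empty)
next
  case False
  let ?n = "CARD('n)" and ?m = "CARD('m)"
  let ?Q = "{x \<in> A. cell s x = q}"
  obtain x0 where x0: "x0 \<in> ?Q" using False by blast
  have n: "real ?n \<ge> 1" and m: "real ?m \<ge> 1" by (simp_all add: Suc_le_eq)
  have "D > 0" unfolding D using \<open>L > 0\<close> by simp
  \<comment> \<open>The Lipschitz constant times the diameter bound of a cell. The constant in
    \<open>D\<close> is such that D/s = 3 n a.\<close>
  define a where "a = 2 * ?m * L / s"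
  have "a > 0" unfolding a_def using \<open>L > 0\<close> \<open>s > 0\<close> by simp
  have dist_Q: "dist x y \<le> 2 * ?m / s" if "x \<in> ?Q" "y \<in> ?Q" for x y
    using that \<open>s > 0\<close> by (intro dist_le_cell) auto
  have fst_Q: "\<bar>fst (f x) $ i - fst (f y) $ i\<bar> \<le> a" if "x \<in> ?Q" "y \<in> ?Q" for x y i
  proof -
    have "\<bar>(fst (f x) - fst (f y)) $ i\<bar> \<le> norm (fst (f x) - fst (f y))"
      by (rule component_le_norm_cart)
    also have "\<dots> \<le> parabolic_dist (f x) (f y)"
      by (rule norm_fst_diff_le_parabolic_dist)
    also have "\<dots> \<le> L * dist x y"
      using lip that by simp
    also have "\<dots> \<le> a"
      using mult_left_mono[OF dist_Q[OF that], of L] \<open>L > 0\<close> by (simp add: a_def mult_ac)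
    finally show ?thesis by simp
  qed
  have snd_Q: "sqrt \<bar>snd (f x) - snd (f y)\<bar> \<le> 2 * a / p" if "x \<in> ?Q" "y \<in> ?Q" for x y
  proof -
    have "\<bar>snd (f x) - snd (f y)\<bar> \<le> L\<^sup>2 * (dist x y)\<^sup>2" if "x \<in> A" "y \<in> A" for x y
    proof -
      have "(parabolic_dist (f x) (f y))\<^sup>2 \<le> (L * dist x y)\<^sup>2"
        using lip[OF that] by (rule power_mono) (rule parabolic_dist_nonneg)
      then show ?thesis
        using abs_snd_diff_le_parabolic_dist[of "f x" "f y"] by (simp add: power_mult_distrib)
    qed
    from oscillation_on_full_cell[OF this _ \<open>s > 0\<close> _ full, of x y]
    have "\<bar>snd (f x) - snd (f y)\<bar> \<le> (real (p\<^sup>2) + 2) * (L\<^sup>2 * (2 * ?m / (s * real (p\<^sup>2)))\<^sup>2)"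
      using that \<open>p > 0\<close> by simp
    also have "L\<^sup>2 * (2 * ?m / (s * real (p\<^sup>2)))\<^sup>2 = (a / (real p)\<^sup>2)\<^sup>2"
      by (simp add: a_def power_mult_distrib power_divide mult_ac)
    \<comment> \<open>The factor 4 is chosen to be a perfect square, as a square root is taken
      next.\<close>
    also have "(real (p\<^sup>2) + 2) * (a / (real p)\<^sup>2)\<^sup>2 \<le> (4 * (real p)\<^sup>2) * (a / (real p)\<^sup>2)\<^sup>2"
    proof (rule mult_right_mono)
      have "1 \<le> (real p)\<^sup>2" using \<open>p > 0\<close> by (intro one_le_power) simp
      then show "real (p\<^sup>2) + 2 \<le> 4 * (real p)\<^sup>2" unfolding of_nat_power by linarith
    qed simp
    also have "\<dots> = (2 * a / p)\<^sup>2"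
      using \<open>p > 0\<close> by (simp add: field_simps power2_eq_square)
    finally show ?thesis
      using \<open>a > 0\<close> by (intro real_le_lsqrt) auto
  qed
  \<comment> \<open>Grid index at width a/p, with origin at the image of \<open>x0\<close>. Relative
    coordinates lie in [-a, a], so indices lie in -p..p; the right endpoint makes their number 2p +
    1.\<close>
  define k where "k x = (\<chi> i. \<lfloor>p * (fst (f x) $ i - fst (f x0) $ i) / a\<rfloor>)" for x
  define V where "V = {v :: int ^ 'n. \<forall>i. v $ i \<in> {- int p..int p}}"
  have V: "finite V" "card V = (2 * p + 1) ^ ?n"
    unfolding V_def using finite_card_vec_box[of "\<lambda>_. {- int p..int p}"]
    by (auto simp del: atLeastAtMost_iff simp: nat_add_distrib nat_mult_distrib)
  have kV: "k x \<in> V" if "x \<in> ?Q" for x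
  proof -
    have "\<bar>p * (fst (f x) $ i - fst (f x0) $ i) / a\<bar> \<le> p" for i
    proof -
      have "\<bar>fst (f x) $ i - fst (f x0) $ i\<bar> / a \<le> 1"
        using fst_Q[OF that x0, of i] \<open>a > 0\<close> by simp
      then have "real p * (\<bar>fst (f x) $ i - fst (f x0) $ i\<bar> / a) \<le> real p * 1"
        by (rule mult_left_mono) simp
      then show ?thesis using \<open>a > 0\<close> by (simp add: abs_mult)
    qed
    moreover have "\<lfloor>z\<rfloor> \<in> {- int p..int p}" if "\<bar>z\<bar> \<le> p" for z :: real
      unfolding atLeastAtMost_iff using that by linarith
    ultimately show ?thesis by (simp add: V_def k_def del: atLeastAtMost_iff)
  qed
  have piece: "hausdorff_pre parabolic_metric (real (?n + 1)) \<delta> (f ` {x \<in> ?Q. k x = v})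
      \<le> ennreal ((D / (s * p)) ^ (?n + 1))" for v
  proof -
    have "hausdorff_pre parabolic_metric (real (?n + 1)) \<delta> (f ` {x \<in> ?Q. k x = v})
      \<le> ennreal ((D / (s * p)) powr real (?n + 1))"
    proof (rule hausdorff_pre_le_powr)
      have "D / (s * p) \<le> D / s"
        using \<open>p > 0\<close> \<open>s > 0\<close> \<open>D > 0\<close> by (intro divide_left_mono) (auto simp: Suc_le_eq)
      then show "D / (s * p) < \<delta>" using \<open>D / s < \<delta>\<close> by linarith
      fix P P' assume "P \<in> f ` {x \<in> ?Q. k x = v}" "P' \<in> f ` {x \<in> ?Q. k x = v}"
      then obtain x y where "x \<in> {x \<in> ?Q. k x = v}" "y \<in> {x \<in> ?Q. k x = v}"
          and P: "P = f x" "P' = f y"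
        by (elim imageE)
      then have xy: "x \<in> ?Q" "y \<in> ?Q" "k x = v" "k y = v" by simp_all
      have "\<bar>(fst (f x) - fst (f y)) $ i\<bar> \<le> a / p" for i
      proof -
        have scale: "\<bar>z\<bar> \<le> a / p" if "\<bar>p / a * z\<bar> \<le> 1" for z :: real
          using that \<open>a > 0\<close> \<open>p > 0\<close> by (simp add: abs_mult field_simps)
        have "k x $ i = k y $ i" using xy(3,4) by simp
        then have "\<lfloor>p * (fst (f x) $ i - fst (f x0) $ i) / a\<rfloor> = \<lfloor>p * (fst (f y) $ i - fst (f x0) $ i) / a\<rfloor>"
          by (simp only: k_def vec_lambda_beta)
        then have "\<bar>p * (fst (f x) $ i - fst (f x0) $ i) / a - p * (fst (f y) $ i - fst (f x0) $ i) / a\<bar> \<le> 1"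
          by linarith
        also have "p * (fst (f x) $ i - fst (f x0) $ i) / a - p * (fst (f y) $ i - fst (f x0) $ i) / a
            = (p / a) * ((fst (f x) - fst (f y)) $ i)"
          using \<open>a > 0\<close> by (simp add: field_simps)
        finally show ?thesis by (rule scale)
      qed
      then have "norm (fst (f x) - fst (f y)) \<le> ?n * (a / p)"
        by (rule norm_le_card_mult)
      then have "parabolic_dist (f x) (f y) \<le> ?n * (a / p) + 2 * (a / p)"
        using parabolic_dist_le[of "f x" "f y"] snd_Q[OF xy(1,2)] by simp
      \<comment> \<open>As n is at least 1, n + 2 is at most 3n.\<close>
      also have "\<dots> \<le> (3 * ?n) * (a / p)"
        unfolding distrib_right[symmetric] using n \<open>a > 0\<close> by (intro mult_right_mono) auto
      also have "\<dots> = D / (s * p)"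
        by (simp add: D a_def)
      finally show "mdist parabolic_metric P P' \<le> D / (s * p)"
        using P by simp
    qed (use \<open>D > 0\<close> \<open>s > 0\<close> in auto)
    then show ?thesis
      using \<open>D > 0\<close> \<open>s > 0\<close> \<open>p > 0\<close> powr_realpow[of "D / (s * p)" "?n + 1"] by simp
  qed
  have "0 < D / s" using \<open>D > 0\<close> \<open>s > 0\<close> by simp
  then have "\<delta> > 0" using \<open>D / s < \<delta>\<close> by linarith
  have decomp: "f ` ?Q = (\<Union>v\<in>V. f ` {x \<in> ?Q. k x = v})"
    using kV by blast
  have "hausdorff_pre parabolic_metric (real (?n + 1)) \<delta> (f ` ?Q)
      \<le> (\<Sum>v\<in>V. hausdorff_pre parabolic_metric (real (?n + 1)) \<delta> (f ` {x \<in> ?Q. k x = v}))"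
    by (subst decomp) (rule hausdorff_pre_finite_UN_le[OF \<open>\<delta> > 0\<close> V(1)])
  also have "\<dots> \<le> (\<Sum>v\<in>V. ennreal ((D / (s * p)) ^ (?n + 1)))"
    by (intro sum_mono piece)
  also have "\<dots> = ennreal (real (card V) * (D / (s * p)) ^ (?n + 1))"
    using \<open>D > 0\<close> \<open>s > 0\<close> by (subst sum_ennreal) auto
  also have "\<dots> \<le> ennreal ((3 * real p) ^ ?n * (D / (s * p)) ^ (?n + 1))"
    unfolding V of_nat_power using \<open>p > 0\<close> \<open>D > 0\<close> \<open>s > 0\<close>
    by (intro ennreal_leI mult_right_mono power_mono) auto
  also have "(3 * real p) ^ ?n * (D / (s * p)) ^ (?n + 1)
      = 3 ^ ?n * D ^ (?n + 1) / (real p * s ^ (?n + 1))"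
    using \<open>p > 0\<close> \<open>s > 0\<close> by (simp add: power_mult_distrib power_divide field_simps)
  finally show ?thesis .
qed

text \<open>Here the image of the cell is a single covering set. The factor 3^n is inserted so that
  full and defective cells share one constant.\<close>

lemma hausdorff_pre_cell:
  fixes A :: "(real ^ 'm) set" and f :: "real ^ 'm \<Rightarrow> (real ^ 'n) \<times> real" and L :: real
  assumes lip: "\<And>x y. x \<in> A \<Longrightarrow> y \<in> A \<Longrightarrow> parabolic_dist (f x) (f y) \<le> L * dist x y"
    and "L > 0" "s > 0" and D: "D = 6 * CARD('n) * CARD('m) * L" and "D / s < \<delta>"
  shows "hausdorff_pre parabolic_metric (real (CARD('n) + 1)) \<delta> (f ` {x \<in> A. cell s x = q})
     \<le> ennreal (3 ^ CARD('n) * D ^ (CARD('n) + 1) / s ^ (CARD('n) + 1))"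
proof -
  let ?n = "CARD('n)" and ?m = "CARD('m)"
  have n: "real ?n \<ge> 1" by (simp add: Suc_le_eq)
  have "D > 0" unfolding D using \<open>L > 0\<close> by simp
  have "hausdorff_pre parabolic_metric (real (?n + 1)) \<delta> (f ` {x \<in> A. cell s x = q})
      \<le> ennreal ((D / s) powr real (?n + 1))"
  proof (rule hausdorff_pre_le_powr)
    fix P P' assume "P \<in> f ` {x \<in> A. cell s x = q}" "P' \<in> f ` {x \<in> A. cell s x = q}"
    then obtain x y where xy: "x \<in> A" "y \<in> A" "cell s x = cell s y" "P = f x" "P' = f y"
      by auto
    have "dist x y \<le> 2 * ?m / s" using xy \<open>s > 0\<close> by (intro dist_le_cell) auto
    then have "L * dist x y \<le> L * (2 * ?m / s)"
      by (rule mult_left_mono) (use \<open>L > 0\<close> in simp)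
    also have "\<dots> \<le> (3 * ?n) * (L * (2 * ?m / s))"
      using mult_right_mono[of 1 "3 * real ?n" "L * (2 * ?m / s)"] n \<open>L > 0\<close> \<open>s > 0\<close> by simp
    also have "\<dots> = D / s" by (simp add: D)
    finally show "mdist parabolic_metric P P' \<le> D / s"
      using lip[of x y] xy by simp
  qed (use \<open>D > 0\<close> \<open>s > 0\<close> \<open>D / s < \<delta>\<close> in auto)
  also have "(D / s) powr real (?n + 1) = (D / s) ^ (?n + 1)"
    using \<open>D > 0\<close> \<open>s > 0\<close> by (intro powr_realpow) auto
  also have "\<dots> \<le> 3 ^ ?n * (D / s) ^ (?n + 1)"
    using \<open>D > 0\<close> \<open>s > 0\<close> mult_right_mono[of 1 "3 ^ ?n" "(D / s) ^ (?n + 1)"] by simp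
  finally show ?thesis by (simp add: power_divide ennreal_leI)
qed

section \<open>Summation over cells and passage to the limit\<close>

text \<open>By \<open>dim\<close> the exponent n + 1 is the dimension of the domain, so the sums of
  cell bounds become multiples of volumes. The scale tends to 0 first, with p fixed; then p tends to
  infinity.\<close>

lemma hausdorff_pre_lipschitz_image_bounded:
  fixes A :: "(real ^ 'm) set" and f :: "real ^ 'm \<Rightarrow> (real ^ 'n) \<times> real" and L :: real
  assumes dim: "CARD('m) = CARD('n) + 1" and "bounded A" "\<delta> > 0" "L > 0"
    and lip: "\<And>x y. x \<in> A \<Longrightarrow> y \<in> A \<Longrightarrow> parabolic_dist (f x) (f y) \<le> L * dist x y"
  shows "hausdorff_pre parabolic_metric (real (CARD('n) + 1)) \<delta> (f ` A) = 0"
proof -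
  let ?n = "CARD('n)" and ?m = "CARD('m)"
  define D where "D = 6 * ?n * ?m * L"
  define C where "C = 3 ^ ?n * D ^ ?m"
  have "D > 0" unfolding D_def using \<open>L > 0\<close> by simp
  then have "C > 0" by (simp add: C_def)
  let ?H = "hausdorff_pre parabolic_metric (real (?n + 1)) \<delta>"
  define N where "N s = real (card (cell s ` A))" for s
  have bound: "?H (f ` A) \<le> ennreal (C * N 1 / p)" if "p > 1" for p :: nat
  proof -
    define K where "K = p\<^sup>2"
    have "K > 1" using that unfolding K_def by (intro one_less_power) auto
    \<comment> \<open>The total volume of the cells of side K^(-j) that meet A.\<close>
    define V where "V j = N (real K ^ j) / (real K ^ j) ^ ?m" for j
    have V_dec: "V (Suc j) \<le> V j"
      and est: "D / real K ^ j < \<delta> \<Longrightarrow>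
        ?H (f ` A) \<le> ennreal (C * V j / p + C * (real K ^ ?m * (V j - V (Suc j))))" for j
    proof -
      define s where "s = real K ^ j"
      have "s > 0" using \<open>K > 1\<close> by (simp add: s_def)
      let ?S = "cell s ` A"
      define B where "B = {q \<in> ?S. \<not> subcells K q \<subseteq> cell (s * real K) ` A}"
      have fin: "finite ?S" using \<open>bounded A\<close> by (rule finite_cell_image)
      have "card (cell (s * real K) ` A) + card B \<le> K ^ ?m * card ?S"
        unfolding B_def using \<open>bounded A\<close> \<open>K > 1\<close> by (intro card_cell_image_refine) auto
      then have "N (s * real K) + real (card B) \<le> real K ^ ?m * N s"
        unfolding N_def by (simp flip: of_nat_add of_nat_mult of_nat_power)
      then have "(N (s * real K) + real (card B)) / (s * real K) ^ ?m \<le> real K ^ ?m * N s / (s * real K) ^ ?m"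
        using \<open>s > 0\<close> by (intro divide_right_mono) auto
      moreover have "V j = real K ^ ?m * N s / (s * real K) ^ ?m"
        using \<open>K > 1\<close> \<open>s > 0\<close> by (simp add: V_def power_mult_distrib flip: s_def)
      moreover have "V (Suc j) = N (s * real K) / (s * real K) ^ ?m"
        by (simp add: V_def s_def mult.commute)
      ultimately have B_le: "real (card B) / (s * real K) ^ ?m \<le> V j - V (Suc j)"
        by (simp add: add_divide_distrib)
      have "0 \<le> real (card B) / (s * real K) ^ ?m" using \<open>s > 0\<close> by simp
      then show "V (Suc j) \<le> V j" using B_le by linarith
      \<comment> \<open>The volume loss was measured in subcells; the factor K^m converts it to the
        volume of the defective cells themselves.\<close>
      have B_le': "real (card B) / s ^ ?m \<le> real K ^ ?m * (V j - V (Suc j))"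
        using mult_left_mono[OF B_le, of "real K ^ ?m"] \<open>K > 1\<close> by (simp add: power_mult_distrib)
      assume "D / real K ^ j < \<delta>"
      then have "D / s < \<delta>" by (simp add: s_def)
      have decomp: "f ` A = (\<Union>q\<in>?S. f ` {x \<in> A. cell s x = q})" by blast
      have "?H (f ` A) \<le> (\<Sum>q\<in>?S. ?H (f ` {x \<in> A. cell s x = q}))"
        by (subst decomp) (rule hausdorff_pre_finite_UN_le[OF \<open>\<delta> > 0\<close> fin])
      \<comment> \<open>Every cell is charged the full-cell bound, and the defective ones in
        \<open>B\<close> pay the crude bound on top.\<close>
      also have "\<dots> \<le> (\<Sum>q\<in>?S. ennreal (C / s ^ ?m / p + (if q \<in> B then C / s ^ ?m else 0)))"
      proof (rule sum_mono)
        fix q assume "q \<in> ?S"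
        show "?H (f ` {x \<in> A. cell s x = q}) \<le> ennreal (C / s ^ ?m / p + (if q \<in> B then C / s ^ ?m else 0))"
        proof (cases "q \<in> B")
          case True
          have "?H (f ` {x \<in> A. cell s x = q}) \<le> ennreal (C / s ^ ?m)"
            using hausdorff_pre_cell[OF lip \<open>L > 0\<close> \<open>s > 0\<close> D_def \<open>D / s < \<delta>\<close>, where q = q]
            by (simp add: C_def dim)
          also have "\<dots> \<le> ennreal (C / s ^ ?m / p + C / s ^ ?m)"
            using \<open>C > 0\<close> \<open>s > 0\<close> by (intro ennreal_leI) auto
          finally show ?thesis using True by simp
        next
          case False
          then have "subcells (p\<^sup>2) q \<subseteq> cell (s * real (p\<^sup>2)) ` A"
            using \<open>q \<in> ?S\<close> by (simp add: B_def K_def)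
          from hausdorff_pre_full_cell[OF lip \<open>L > 0\<close> \<open>s > 0\<close> _ this D_def \<open>D / s < \<delta>\<close>] \<open>p > 1\<close> False
          show ?thesis by (simp add: C_def dim mult_ac)
        qed
      qed
      also have "\<dots> = ennreal (\<Sum>q\<in>?S. C / s ^ ?m / p + (if q \<in> B then C / s ^ ?m else 0))"
        using \<open>C > 0\<close> \<open>s > 0\<close> by (intro sum_ennreal) auto
      also have "(\<Sum>q\<in>?S. C / s ^ ?m / p + (if q \<in> B then C / s ^ ?m else 0))
          = N s * (C / s ^ ?m / p) + real (card B) * (C / s ^ ?m)"
      proof -
        have "?S \<inter> B = B" by (auto simp: B_def)
        then show ?thesis
          using fin by (simp add: sum.distrib N_def sum.If_cases)
      qed
      also have "\<dots> = C * V j / p + C * (real (card B) / s ^ ?m)"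
        by (simp add: V_def mult.commute flip: s_def)
      also have "\<dots> \<le> C * V j / p + C * (real K ^ ?m * (V j - V (Suc j)))"
        using mult_left_mono[OF B_le', of C] \<open>C > 0\<close> by simp
      finally show "?H (f ` A) \<le> ennreal (C * V j / p + C * (real K ^ ?m * (V j - V (Suc j))))"
        by (simp add: ennreal_leI)
    qed
    have "decseq V" using V_dec by (rule decseq_SucI)
    have V_nonneg: "0 \<le> V j" for j by (simp add: V_def N_def)
    obtain l where l: "V \<longlonglongrightarrow> l"
      using decseq_convergent[OF \<open>decseq V\<close>, of 0] V_nonneg by blast
    \<comment> \<open>The bound is V 0 = N 1, which does not depend on p; the final limit relies on
      this.\<close>
    have V_le: "V j \<le> N 1" for j
      using decseqD[OF \<open>decseq V\<close>, of 0 j] by (simp add: V_def)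
    have "(\<lambda>j. D / real K ^ j) \<longlonglongrightarrow> 0"
      using \<open>K > 1\<close> by (intro LIMSEQ_divide_realpow_zero) simp
    then have "\<forall>\<^sub>F j in sequentially. D / real K ^ j < \<delta>"
      using \<open>\<delta> > 0\<close> by (rule order_tendstoD(2))
    then have ev: "\<forall>\<^sub>F j in sequentially.
        ?H (f ` A) \<le> ennreal (C * N 1 / p + C * (real K ^ ?m * (V j - V (Suc j))))"
    proof eventually_elim
      case (elim j)
      have "C * V j / p \<le> C * N 1 / p"
        using V_le[of j] \<open>C > 0\<close> by (intro divide_right_mono mult_left_mono) auto
      then show ?case
        using est[OF elim] by (elim order_trans) (intro ennreal_leI, simp)
    qed
    \<comment> \<open>As j grows, consecutive differences of the convergent \<open>V\<close> tend to
      0, and the factor K^m, however large, is constant.\<close>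
    have "(\<lambda>j. ennreal (C * N 1 / p + C * (real K ^ ?m * (V j - V (Suc j)))))
        \<longlonglongrightarrow> ennreal (C * N 1 / p + C * (real K ^ ?m * (l - l)))"
      by (intro tendsto_intros l LIMSEQ_Suc)
    from tendsto_lowerbound[OF this ev] show ?thesis by simp
  qed
  have "(\<lambda>p. ennreal (C * N 1 / real p)) \<longlonglongrightarrow> ennreal 0"
    by (intro tendsto_ennrealI lim_const_over_n)
  moreover have "\<forall>\<^sub>F p in sequentially. ?H (f ` A) \<le> ennreal (C * N 1 / real p)"
    using eventually_gt_at_top[of 1] by eventually_elim (rule bound)
  ultimately have "?H (f ` A) \<le> ennreal 0"
    by (rule tendsto_lowerbound) simp
  then show ?thesis by simp
qed

theorem theorem7p2:
  fixes A :: "(real ^ 'm) set" and f :: "real ^ 'm \<Rightarrow> (real ^ 'n) \<times> real"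
  assumes "CARD('m) = CARD('n) + 1"
    and "Lipschitz_continuous_map (submetric euclidean_metric A) parabolic_metric f"
  shows "hausdorff_measure parabolic_metric (real (CARD('n) + 1)) (f ` A) = 0"
proof -
  obtain L where "L > 0"
    and L: "\<And>x y. x \<in> A \<Longrightarrow> y \<in> A \<Longrightarrow> parabolic_dist (f x) (f y) \<le> L * dist x y"
    using assms(2) by (auto simp: Lipschitz_continuous_map_pos)
  have "hausdorff_pre parabolic_metric (real (CARD('n) + 1)) \<delta> (f ` A) = 0" if "\<delta> > 0" for \<delta>
  proof -
    let ?H = "hausdorff_pre parabolic_metric (real (CARD('n) + 1)) \<delta>"
    \<comment> \<open>Balls make the pieces bounded, so that each meets finitely many cells;
      countable subadditivity reassembles them.\<close>
    let ?A = "\<lambda>i. A \<inter> cball 0 (real i)"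
    have "A = (\<Union>i. ?A i)"
      using real_arch_simple by (auto simp: dist_norm)
    then have decomp: "f ` A = (\<Union>i. f ` ?A i)" by blast
    have "?H (f ` A) \<le> (\<Sum>i. ?H (f ` ?A i))"
      by (subst decomp) (rule hausdorff_pre_UN_le)
    also have "\<dots> = 0"
    proof -
      have "?H (f ` ?A i) = 0" for i
        by (rule hausdorff_pre_lipschitz_image_bounded[OF assms(1) _ \<open>\<delta> > 0\<close> \<open>L > 0\<close>])
           (use L in \<open>auto intro: bounded_subset[OF bounded_cball]\<close>)
      then show ?thesis by simp
    qed
    finally show ?thesis by simp
  qed
  then show ?thesis by (simp add: hausdorff_measure_eq_SUP)
qed

end
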